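(* Let $Y=[0,1]^d$ with a probability measure $\mu$, let $L\geq 1$, let $\mathcal{L}^{\Delta_\ell}:Y\to\mathbb{R}$, $0\leq\ell\leq L$, be the parameters-to-observable maps computed at mesh resolutions $\Delta_0>\Delta_1>\dots>\Delta_L>0$, and let $\mathcal{D}_\ell=\mathcal{L}^{\Delta_\ell}-\mathcal{L}^{\Delta_{\ell-1}}$, $1\le\ell\le L$, be the details. Let $\mathcal{L}_0^{\ast}$ and $\mathcal{D}_\ell^{\ast}$ ($1\le\ell\le L$) be the neural networks trained with $N_0$ and $N_\ell$ samples, respectively, and let $\mathcal{L}^{\ast}_{ml}=\mathcal{L}_0^{\ast}+\sum_{\ell=1}^L\mathcal{D}_\ell^{\ast}$ be the network produced by the multi-level deep learning algorithm described in the context. With the cumulative generalization errors $\bar{\mathcal{E}}_G^{ml}$, $\bar{\mathcal{E}}_G^{\ell}$, cumulative training errors $\bar{\mathcal{E}}_T^{\ell}$, validation gaps $\mathcal{E}_{TV}^{\ell}$ ($0\le\ell\le L$) and variances $\mathbb{V}$ defined in the context, the following estimates hold: $$ \bar{\mathcal{E}}_G^{ml}\leq\bar{\mathcal{E}}_G^0+\sum_{\ell=1}^L\bar{\mathcal{E}}_G^\ell, $$ $$ |\bar{\mathcal{E}}_G^0-\bar{\mathcal{E}}_T^0|\leq\mathcal{E}_{TV}^0+\sqrt{\frac{8\left(\mathbb{V}(\mathcal{L}^{\Delta_0})+\mathbb{V}(\mathcal{L}_0^{\ast})\right)}{N_0}}, $$ $$ |\bar{\mathcal{E}}_G^\ell-\bar{\mathcal{E}}_T^\ell|\leq\mathcal{E}_{TV}^\ell+\sqrt{\frac{8\left(\mathbb{V}(\mathcal{D}_\ell)+\mathbb{V}(\mathcal{D}_\ell^{\ast})\right)}{N_\ell}}\qquad\text{for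 all }1\leq\ell\leq L. $$
   Context: **The maps.** For each $\ell$, $\mathcal{L}^{\Delta_\ell}:Y\to\mathbb{R}$ is a given function assigning to $y\in Y$ the value of an observable (an integral functional of the solution) of a generic parametric PDE, computed numerically at resolution $\Delta_\ell$. No structure of the PDE enters beyond the resulting functions. The map $\mathcal{L}^{\Delta_L}$ at the finest resolution is taken as the ground truth. **Notation.** To treat all levels uniformly, write $F_0=\mathcal{L}^{\Delta_0}$, $F_0^{\ast}=\mathcal{L}_0^{\ast}$ and $F_\ell=\mathcal{D}_\ell$, $F_\ell^{\ast}=\mathcal{D}_\ell^{\ast}$ for $1\le\ell\le L$. **Multi-level deep learning algorithm.** For each $0\le\ell\le L$ a training set of $N_\ell$ points drawn i.i.d. from $\mu$ is chosen and identified with a vector $\mathbf{S}_\ell=[y_1^\ell,\dots,y_{N_\ell}^\ell]\in Y^{N_\ell}$ with law $\mu^{N_\ell}$ (the product measure). From the data $\{(y_i^\ell,F_\ell(y_i^\ell))\}_{i=1}^{N_\ell}$ a neural network $F_\ell^{\ast}(\cdot;\mathbf{S}_\ell):Y\to\mathbb{R}$ is trained as follows. Fix a feedforward architecture $\mathcal{N}_\theta(y)=C_K\circ\sigma\circ C_{K-1}\circ\cdots\circ\sigma\circ C_1(y)$ with $\sigma(z)=\max(z,0)$ componentwise, affine maps $C_kz=W_kz+b_k$ (input dimension of $C_1$ equal to $d$, output dimension of $C_K$ equal to $1$) and weights $\theta=\{W_k,b_k\}_k\in\Theta\subset\mathbb{R}^M$. A gradient descent type method is run to approximately minimize $\sum_{i=1}^{N_\ell}|F_\ell(y_i^\ell)-\mathcal{N}_\theta(y_i^\ell)|^p+\lambda\mathcal{R}(\theta)$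 over $\theta\in\Theta$, where $1\le p<\infty$, $\lambda\ge0$ and $\mathcal{R}:\Theta\to\mathbb{R}$ is a regularization term. It returns $\theta^{\ast}(\mathbf{S}_\ell)$ (an approximate local minimum; no quantitative accuracy is assumed), and $F_\ell^{\ast}(y;\mathbf{S}_\ell):=\mathcal{N}_{\theta^{\ast}(\mathbf{S}_\ell)}(y)$. The networks on different levels are trained independently. The multi-level network is $$\mathcal{L}_{ml}^{\ast}(y;\bar{\mathbf{S}})=\mathcal{L}_0^{\ast}(y;\mathbf{S}_0)+\sum_{\ell=1}^L\mathcal{D}_\ell^{\ast}(y;\mathbf{S}_\ell),\qquad \bar{\mathbf{S}}=[\mathbf{S}_0,\dots,\mathbf{S}_L]\in Y^{\bar N},$$ with $\bar N=\sum_{\ell=0}^LN_\ell$, $Y^{\bar N}=Y^{N_0}\times\cdots\times Y^{N_L}$ and $\mu^{\bar N}=\mu^{N_0}\otimes\cdots\otimes\mu^{N_L}$. **Integrability.** Each $F_\ell$ is measurable and square integrable with respect to $\mu$, and each $F_\ell^{\ast}$ is measurable and square integrable with respect to $\mu\otimes\mu^{N_\ell}$. **Errors.** $$\bar{\mathcal{E}}_G^{ml}=\int_{Y^{\bar N}}\int_Y|\mathcal{L}^{\Delta_L}(y)-\mathcal{L}_{ml}^{\ast}(y;\bar{\mathbf{S}})|\,d\mu(y)\,d\mu^{\bar N}(\bar{\mathbf{S}}),$$ and for $0\le\ell\le L$ $$\bar{\mathcal{E}}_G^\ell=\int_{Y^{N_\ell}}\int_Y|F_\ell(y)-F_\ell^{\ast}(y;\mathbf{S}_\ell)|\,d\mu(y)\,d\mu^{N_\ell}(\mathbf{S}_\ell),$$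 $$\bar{\mathcal{E}}_T^\ell=\frac1{N_\ell}\int_{Y^{N_\ell}}\sum_{i=1}^{N_\ell}|F_\ell(y_i^\ell)-F_\ell^{\ast}(y_i^\ell;\mathbf{S}_\ell)|\,d\mu^{N_\ell}(\mathbf{S}_\ell).$$ Let $(\Omega,\Sigma,\mathbb{P})$ be a complete probability space. For each $\ell$ the validation set consists of $N_\ell$ random points $z_1^\ell,\dots,z_{N_\ell}^\ell:\Omega\to Y$, i.i.d. with law $\mu$, chosen independently of the training sets. The cumulative validation error and validation gap are $$\bar{\mathcal{E}}_V^\ell(\omega)=\frac1{N_\ell}\int_{Y^{N_\ell}}\sum_{j=1}^{N_\ell}|F_\ell(z_j^\ell(\omega))-F_\ell^{\ast}(z_j^\ell(\omega);\mathbf{S}_\ell)|\,d\mu^{N_\ell}(\mathbf{S}_\ell),\qquad \mathcal{E}_{TV}^\ell=\int_\Omega|\bar{\mathcal{E}}_T^\ell-\bar{\mathcal{E}}_V^\ell(\omega)|\,d\mathbb{P}(\omega).$$ **Variances.** For $0\le\ell\le L$, $$\mathbb{V}(F_\ell)=\int_YF_\ell(y)^2\,d\mu(y)-\Big(\int_YF_\ell(y)\,d\mu(y)\Big)^2,$$ $$\mathbb{V}(F_\ell^{\ast})=\int_Y\int_{Y^{N_\ell}}F_\ell^{\ast}(y;\mathbf{S}_\ell)^2\,d\mu^{N_\ell}(\mathbf{S}_\ell)\,d\mu(y)-\Big(\int_Y\int_{Y^{N_\ell}}F_\ell^{\ast}(y;\mathbf{S}_\ell)\,d\mu^{N_\ell}(\mathbf{S}_\ell)\,d\mu(y)\Big)^2.$$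 *)

theory Defs
  imports "Jordan_Normal_Form.Matrix" "HOL-Probability.Probability"
begin

text \<open>
  A weight tuple \<open>\<theta>\<close> is the list \<open>[(W\<^sub>1, b\<^sub>1), \<dots>, (W\<^sub>K, b\<^sub>K)]\<close>. Layer dimensions vary along this list,
  so the layers use the matrices and vectors of \<open>Jordan_Normal_Form\<close>, whose dimensions are values
  rather than types. For a fixed architecture \<open>dims\<close>, the set \<open>weights dims\<close> is a copy of \<open>\<real>\<^sup>M\<close>,
  \<open>M\<close> being the total number of entries.
\<close>

type_synonym weight_tuple = "(real Matrix.mat \<times> real Matrix.vec) list"

definition relu :: "real Matrix.vec \<Rightarrow> real Matrix.vec" where
  "relu v = map_vec (\<lambda>t. max t 0) v"

definition affine :: "real Matrix.mat \<times> real Matrix.vec \<Rightarrow> real Matrix.vec \<Rightarrow> real Matrix.vec" where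
  "affine C z = fst C *\<^sub>v z + snd C"

fun feedforward :: "weight_tuple \<Rightarrow> real Matrix.vec \<Rightarrow> real Matrix.vec" where
  "feedforward [] z = z"
| "feedforward [C] z = affine C z"
| "feedforward (C # C' # Cs) z = feedforward (C' # Cs) (relu (affine C z))"

text \<open>
  \<open>dims = [n\<^sub>0, \<dots>, n\<^sub>K]\<close> with \<open>K \<ge> 1\<close> lists the input dimension, the hidden widths and the output
  dimension.
\<close>

definition architecture :: "nat \<Rightarrow> nat list \<Rightarrow> bool" where
  "architecture d dims \<longleftrightarrow> length dims \<ge> 2 \<and> hd dims = d \<and> last dims = 1"

definition weights :: "nat list \<Rightarrow> weight_tuple set" where
  "weights dims = {\<theta>. length dims = length \<theta> + 1 \<and>
     (\<forall>k<length \<theta>. fst (\<theta> ! k) \<in> carrier_mat (dims ! (k + 1)) (dims ! k) \<and>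
                   snd (\<theta> ! k) \<in> carrier_vec (dims ! (k + 1)))}"

text \<open>
  \<open>from_nat_into UNIV\<close> maps \<open>{..<CARD('d)}\<close> bijectively onto the finite index type \<open>'d\<close>; another
  enumeration of the coordinates would only permute the columns of \<open>W\<^sub>1\<close>.
\<close>

definition coord_vec :: "real ^ 'd \<Rightarrow> real Matrix.vec" where
  "coord_vec y = Matrix.vec CARD('d) (\<lambda>i. vec_nth y (from_nat_into UNIV i))"

definition neural_net :: "weight_tuple \<Rightarrow> real ^ 'd \<Rightarrow> real" where
  "neural_net \<theta> y = vec_index (feedforward \<theta> (coord_vec y)) 0"

text \<open>A sample of \<open>n\<close> points is a function \<open>S\<close> on the index set \<open>{1..n}\<close>.\<close>

definition sample_measure :: "'a measure \<Rightarrow> nat \<Rightarrow> (nat \<Rightarrow> 'a) measure" where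
  "sample_measure \<mu> n = PiM {1..n} (\<lambda>_. \<mu>)"

definition training_data :: "nat \<Rightarrow> ('a \<Rightarrow> real) \<Rightarrow> (nat \<Rightarrow> 'a) \<Rightarrow> ('a \<times> real) list" where
  "training_data n F S = map (\<lambda>i. (S i, F (S i))) [1..<Suc n]"

definition training_objective ::
  "real \<Rightarrow> real \<Rightarrow> (weight_tuple \<Rightarrow> real) \<Rightarrow> ((real ^ 'd) \<times> real) list \<Rightarrow> weight_tuple \<Rightarrow> real" where
  "training_objective p lam R data \<theta> =
     (\<Sum>(y, v)\<leftarrow>data. \<bar>v - neural_net \<theta> y\<bar> powr p) + lam * R \<theta>"

text \<open>
  The training method \<open>opt\<close> receives the data and the objective to be minimized and returns weights.
  It is not required to attain any particular accuracy.
\<close>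

definition trained_weights ::
  "(((real ^ 'd) \<times> real) list \<Rightarrow> (weight_tuple \<Rightarrow> real) \<Rightarrow> weight_tuple) \<Rightarrow> real \<Rightarrow> real \<Rightarrow>
   (weight_tuple \<Rightarrow> real) \<Rightarrow> nat \<Rightarrow> (real ^ 'd \<Rightarrow> real) \<Rightarrow> (nat \<Rightarrow> real ^ 'd) \<Rightarrow> weight_tuple" where
  "trained_weights opt p lam R n F S =
     opt (training_data n F S) (training_objective p lam R (training_data n F S))"

definition trained_net ::
  "(((real ^ 'd) \<times> real) list \<Rightarrow> (weight_tuple \<Rightarrow> real) \<Rightarrow> weight_tuple) \<Rightarrow> real \<Rightarrow> real \<Rightarrow>
   (weight_tuple \<Rightarrow> real) \<Rightarrow> nat \<Rightarrow> (real ^ 'd \<Rightarrow> real) \<Rightarrow> real ^ 'd \<Rightarrow> (nat \<Rightarrow> real ^ 'd) \<Rightarrow> real" where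
  "trained_net opt p lam R n F y S = neural_net (trained_weights opt p lam R n F S) y"

fun level_map :: "(real \<Rightarrow> 'a \<Rightarrow> real) \<Rightarrow> (nat \<Rightarrow> real) \<Rightarrow> nat \<Rightarrow> 'a \<Rightarrow> real" where
  "level_map obs \<Delta> 0 = obs (\<Delta> 0)"
| "level_map obs \<Delta> (Suc l) = (\<lambda>y. obs (\<Delta> (Suc l)) y - obs (\<Delta> l) y)"

definition ml_net ::
  "nat \<Rightarrow> (nat \<Rightarrow> 'a \<Rightarrow> (nat \<Rightarrow> 'a) \<Rightarrow> real) \<Rightarrow> 'a \<Rightarrow> (nat \<Rightarrow> nat \<Rightarrow> 'a) \<Rightarrow> real" where
  "ml_net L Fs y Sbar = Fs 0 y (Sbar 0) + (\<Sum>l=1..L. Fs l y (Sbar l))"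

definition ml_sample_measure :: "'a measure \<Rightarrow> nat \<Rightarrow> (nat \<Rightarrow> nat) \<Rightarrow> (nat \<Rightarrow> nat \<Rightarrow> 'a) measure" where
  "ml_sample_measure \<mu> L N = PiM {0..L} (\<lambda>l. sample_measure \<mu> (N l))"

text \<open>All integrals are Bochner integrals, with value \<open>0\<close> for a non-integrable integrand.\<close>

definition ml_generalization_error ::
  "'a measure \<Rightarrow> nat \<Rightarrow> (nat \<Rightarrow> nat) \<Rightarrow> ('a \<Rightarrow> real) \<Rightarrow> (nat \<Rightarrow> 'a \<Rightarrow> (nat \<Rightarrow> 'a) \<Rightarrow> real) \<Rightarrow> real" where
  "ml_generalization_error \<mu> L N G Fs =
     (LINT Sbar|ml_sample_measure \<mu> L N. LINT y|\<mu>. \<bar>G y - ml_net L Fs y Sbar\<bar>)"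

definition generalization_error ::
  "'a measure \<Rightarrow> nat \<Rightarrow> ('a \<Rightarrow> real) \<Rightarrow> ('a \<Rightarrow> (nat \<Rightarrow> 'a) \<Rightarrow> real) \<Rightarrow> real" where
  "generalization_error \<mu> n F Fs =
     (LINT S|sample_measure \<mu> n. LINT y|\<mu>. \<bar>F y - Fs y S\<bar>)"

definition training_error ::
  "'a measure \<Rightarrow> nat \<Rightarrow> ('a \<Rightarrow> real) \<Rightarrow> ('a \<Rightarrow> (nat \<Rightarrow> 'a) \<Rightarrow> real) \<Rightarrow> real" where
  "training_error \<mu> n F Fs =
     1 / real n * (LINT S|sample_measure \<mu> n. (\<Sum>i=1..n. \<bar>F (S i) - Fs (S i) S\<bar>))"

text \<open>
  The validation points are random variables on a separate space, while the training sample is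
  integrated against its own law: this is how validation and training sets are independent.
\<close>

definition validation_error ::
  "'a measure \<Rightarrow> nat \<Rightarrow> ('a \<Rightarrow> real) \<Rightarrow> ('a \<Rightarrow> (nat \<Rightarrow> 'a) \<Rightarrow> real) \<Rightarrow> (nat \<Rightarrow> 'w \<Rightarrow> 'a) \<Rightarrow> 'w \<Rightarrow> real" where
  "validation_error \<mu> n F Fs z \<omega> =
     1 / real n * (LINT S|sample_measure \<mu> n. (\<Sum>j=1..n. \<bar>F (z j \<omega>) - Fs (z j \<omega>) S\<bar>))"

definition validation_gap ::
  "'w measure \<Rightarrow> 'a measure \<Rightarrow> nat \<Rightarrow> ('a \<Rightarrow> real) \<Rightarrow> ('a \<Rightarrow> (nat \<Rightarrow> 'a) \<Rightarrow> real) \<Rightarrow>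
   (nat \<Rightarrow> 'w \<Rightarrow> 'a) \<Rightarrow> real" where
  "validation_gap P \<mu> n F Fs z =
     (LINT \<omega>|P. \<bar>training_error \<mu> n F Fs - validation_error \<mu> n F Fs z \<omega>\<bar>)"

definition map_variance :: "'a measure \<Rightarrow> ('a \<Rightarrow> real) \<Rightarrow> real" where
  "map_variance \<mu> F = (LINT y|\<mu>. (F y)\<^sup>2) - (LINT y|\<mu>. F y)\<^sup>2"

definition net_variance :: "'a measure \<Rightarrow> nat \<Rightarrow> ('a \<Rightarrow> (nat \<Rightarrow> 'a) \<Rightarrow> real) \<Rightarrow> real" where
  "net_variance \<mu> n Fs =
     (LINT y|\<mu>. LINT S|sample_measure \<mu> n. (Fs y S)\<^sup>2)
     - (LINT y|\<mu>. LINT S|sample_measure \<mu> n. Fs y S)\<^sup>2"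

end

theory Submission
  imports Defs
begin

text \<open>
  Fix a level and let \<open>E y\<close> be the integral of \<open>\<bar>F y - Fs y S\<bar>\<close> over all training sets \<open>S\<close>. By
  Fubini, the generalization error is the mean of \<open>E\<close> under \<open>\<mu>\<close>, while the validation error is the
  empirical mean of \<open>E\<close> over \<open>N\<close> independent points with law \<open>\<mu>\<close>. The validation error is thus a
  Monte Carlo estimate of the generalization error, and their mean distance is at most
  \<open>sqrt (Var E / N)\<close> (\<open>sample_mean_deviation_le\<close>). The training error is a plain number, even though
  the net depends on its training points; it enters only through the triangle inequality
  \<open>\<bar>G - T\<bar> \<le> \<bar>T - V \<omega>\<bar> + \<bar>G - V \<omega>\<bar>\<close>, whose first summand integrates to the validation gap.

  What remains is \<open>Var E \<le> 2 * (Var F + Var Fs)\<close> (\<open>mean_error_variance_le\<close>). It holds because \<open>E\<close> is a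
  conditional expectation of \<open>\<bar>F - Fs\<bar>\<close> on the product of parameter and sample space, because the
  absolute value does not increase the variance, and because the variance is, up to the factor
  \<open>2\<close>, subadditive.

  The multilevel bound is the triangle inequality for the telescoping decomposition of the
  finest map into its levels; each summand depends on one component of the product of the sample
  spaces only, so its integral over that product is a single-level error.
\<close>

section \<open>Variance estimates\<close>

lemma square_diff_le: "(a - b)\<^sup>2 \<le> 2 * a\<^sup>2 + 2 * b\<^sup>2" for a b :: real
  using zero_le_power2[of "a + b"] by (simp add: power2_sum power2_diff)

context prob_space
begin

lemma square_expectation_le:
  fixes X :: "'a \<Rightarrow> real"
  assumes "random_variable borel X" and "integrable M (\<lambda>x. (X x)\<^sup>2)"
  shows "(expectation X)\<^sup>2 \<le> expectation (\<lambda>x. (X x)\<^sup>2)"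
  using variance_eq[of X] variance_positive[of X] square_integrable_imp_integrable[of X] assms
  by simp

text \<open>The second moments agree, and the square of the mean can only grow.\<close>

lemma variance_abs_le:
  fixes X :: "'a \<Rightarrow> real"
  assumes "random_variable borel X" and "integrable M (\<lambda>x. (X x)\<^sup>2)"
  shows "variance (\<lambda>x. \<bar>X x\<bar>) \<le> variance X"
proof -
  have X: "integrable M X"
    by (rule square_integrable_imp_integrable) fact+
  have "\<bar>expectation X\<bar> \<le> expectation (\<lambda>x. \<bar>X x\<bar>)"
    by (rule integral_abs_bound)
  then have "(expectation X)\<^sup>2 \<le> (expectation (\<lambda>x. \<bar>X x\<bar>))\<^sup>2"
    by (metis abs_ge_zero power2_abs power_mono)
  then show ?thesis
    using variance_eq[of X] variance_eq[of "\<lambda>x. \<bar>X x\<bar>"] X assms by simp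
qed

lemma square_integrable_shift:
  fixes X :: "'a \<Rightarrow> real"
  assumes "random_variable borel X" and "integrable M (\<lambda>x. (X x)\<^sup>2)"
  shows "integrable M (\<lambda>x. (X x - c)\<^sup>2)"
  using assms square_integrable_imp_integrable[OF assms] by (simp add: power2_diff)

lemma square_integrable_diff:
  fixes X Y :: "'a \<Rightarrow> real"
  assumes [measurable]: "random_variable borel X" "random_variable borel Y"
    and "integrable M (\<lambda>x. (X x)\<^sup>2)" "integrable M (\<lambda>x. (Y x)\<^sup>2)"
  shows "integrable M (\<lambda>x. (X x - Y x)\<^sup>2)"
proof (rule Bochner_Integration.integrable_bound)
  show "integrable M (\<lambda>x. 2 * (X x)\<^sup>2 + 2 * (Y x)\<^sup>2)"
    using assms by simp
  show "AE x in M. norm ((X x - Y x)\<^sup>2) \<le> norm (2 * (X x)\<^sup>2 + 2 * (Y x)\<^sup>2)"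
    by (simp add: square_diff_le)
qed measurable

lemma variance_diff_le:
  fixes X Y :: "'a \<Rightarrow> real"
  assumes [measurable]: "random_variable borel X" "random_variable borel Y"
    and X2: "integrable M (\<lambda>x. (X x)\<^sup>2)" and Y2: "integrable M (\<lambda>x. (Y x)\<^sup>2)"
  shows "variance (\<lambda>x. X x - Y x) \<le> 2 * (variance X + variance Y)"
proof -
  let ?X = "\<lambda>x. X x - expectation X" and ?Y = "\<lambda>x. Y x - expectation Y"
  have "integrable M X" "integrable M Y"
    by (rule square_integrable_imp_integrable; fact)+
  then have "variance (\<lambda>x. X x - Y x) = expectation (\<lambda>x. (?X x - ?Y x)\<^sup>2)"
    by (simp add: algebra_simps)
  also have "\<dots> \<le> expectation (\<lambda>x. 2 * (?X x)\<^sup>2 + 2 * (?Y x)\<^sup>2)"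
  proof (rule integral_mono')
    show "(?X x - ?Y x)\<^sup>2 \<le> 2 * (?X x)\<^sup>2 + 2 * (?Y x)\<^sup>2" for x
      by (rule square_diff_le)
  next
    show "integrable M (\<lambda>x. 2 * (?X x)\<^sup>2 + 2 * (?Y x)\<^sup>2)"
      using X2 Y2
      by (intro Bochner_Integration.integrable_add integrable_mult_right square_integrable_shift) auto
  qed simp
  also have "\<dots> = 2 * (variance X + variance Y)"
    using X2 Y2 by (simp add: square_integrable_shift)
  finally show ?thesis .
qed

text \<open>
  This is the Monte Carlo rate. In the square of the centred sum the mixed products integrate to
  \<open>0\<close> by independence, so that square has mean \<open>card I * v\<close>; the square of the first moment is at
  most the second moment.
\<close>

lemma sample_mean_deviation_le:
  fixes X :: "'i \<Rightarrow> 'a \<Rightarrow> real"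
  assumes I: "finite I" "I \<noteq> {}"
    and indep: "indep_vars (\<lambda>_. borel) X I"
    and X2: "\<And>i. i \<in> I \<Longrightarrow> integrable M (\<lambda>x. (X i x)\<^sup>2)"
    and mean: "\<And>i. i \<in> I \<Longrightarrow> expectation (X i) = m"
    and var: "\<And>i. i \<in> I \<Longrightarrow> variance (X i) = v"
  shows "expectation (\<lambda>x. \<bar>m - (\<Sum>i\<in>I. X i x) / real (card I)\<bar>) \<le> sqrt (v / real (card I))"
proof -
  let ?n = "real (card I)" and ?C = "\<lambda>i x. X i x - m"
  have n: "?n > 0"
    using I by (simp add: card_gt_0_iff)
  have [measurable]: "random_variable borel (X i)" if "i \<in> I" for i
    using indep that by (auto simp: indep_vars_def)
  have X: "integrable M (X i)" if "i \<in> I" for i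
    by (rule square_integrable_imp_integrable) (use X2 that in auto)
  have C: "integrable M (?C i)" "expectation (?C i) = 0" if "i \<in> I" for i
    using X that mean by (auto simp: prob_space)
  have indep_C: "indep_vars (\<lambda>_. borel) ?C I"
    by (rule indep_vars_compose2[OF indep]) measurable
  have prod: "integrable M (\<lambda>x. ?C i x * ?C j x) \<and>
      expectation (\<lambda>x. ?C i x * ?C j x) = (if i = j then v else 0)" if "i \<in> I" "j \<in> I" for i j
  proof (cases "i = j")
    case True
    then show ?thesis
      using that X2[of i] var[of i] mean[of i] square_integrable_shift[of "X i" m]
      by (simp add: power2_eq_square)
  next
    case False
    have indep_ij: "indep_vars (\<lambda>_. borel) ?C {i, j}"
      by (rule indep_vars_subset[OF indep_C]) (use that in auto)
    have C_ij: "integrable M (?C k)" if "k \<in> {i, j}" for k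
      using that \<open>i \<in> I\<close> \<open>j \<in> I\<close> C(1) by blast
    have "finite {i, j}"
      by simp
    note indep_vars_lebesgue_integral[OF this indep_ij C_ij] indep_vars_integrable[OF this indep_ij C_ij]
    then show ?thesis
      using False C(2)[OF \<open>i \<in> I\<close>] by simp
  qed
  let ?D = "\<lambda>x. \<bar>m - (\<Sum>i\<in>I. X i x) / ?n\<bar>"
  have D: "(?D x)\<^sup>2 = (\<Sum>i\<in>I. \<Sum>j\<in>I. ?C i x * ?C j x) / ?n\<^sup>2" for x
  proof -
    have "m - (\<Sum>i\<in>I. X i x) / ?n = - (\<Sum>i\<in>I. ?C i x) / ?n"
      using n by (simp add: sum_subtractf field_simps)
    then show ?thesis
      by (simp add: power_divide sum_product power2_eq_square)
  qed
  have "(expectation ?D)\<^sup>2 \<le> expectation (\<lambda>x. (?D x)\<^sup>2)"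
  proof (rule square_expectation_le)
    show "integrable M (\<lambda>x. (?D x)\<^sup>2)"
      unfolding D using prod
      by (intro integrable_divide Bochner_Integration.integrable_sum) auto
  qed measurable
  also have "\<dots> = (\<Sum>i\<in>I. \<Sum>j\<in>I. if i = j then v else 0) / ?n\<^sup>2"
    unfolding D using prod by (simp add: Bochner_Integration.integral_sum)
  also have "\<dots> = v / ?n"
    using n I(1) by (simp add: power2_eq_square)
  finally show ?thesis
    by (rule real_le_rsqrt)
qed

end

context pair_prob_space
begin

text \<open>
  Averaging over the second coordinate is a conditional expectation: it keeps the mean and, by
  \<open>square_expectation_le\<close> on almost every slice, does not increase the second moment.
\<close>

lemma
  fixes f :: "'a \<Rightarrow> 'b \<Rightarrow> real"
  assumes f[measurable]: "case_prod f \<in> borel_measurable (M1 \<Otimes>\<^sub>M M2)"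
    and f2: "integrable (M1 \<Otimes>\<^sub>M M2) (\<lambda>(x, y). (f x y)\<^sup>2)"
  shows marginal_square_integrable: "integrable M1 (\<lambda>x. (LINT y|M2. f x y)\<^sup>2)"
    and marginal_variance_le:
      "M1.variance (\<lambda>x. LINT y|M2. f x y) \<le> variance (case_prod f)"
proof -
  let ?g = "\<lambda>x. LINT y|M2. f x y"
  have f2': "integrable (M1 \<Otimes>\<^sub>M M2) (\<lambda>p. (case_prod f p)\<^sup>2)"
    using f2 by (simp add: case_prod_beta')
  have f1: "integrable (M1 \<Otimes>\<^sub>M M2) (case_prod f)"
    by (rule square_integrable_imp_integrable[OF f f2'])
  have le: "AE x in M1. (?g x)\<^sup>2 \<le> (LINT y|M2. (f x y)\<^sup>2)"
    using AE_integrable_fst[OF f2] AE_space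
  proof eventually_elim
    case (elim x)
    then show ?case
      by (intro M2.square_expectation_le) auto
  qed
  have int: "integrable M1 (\<lambda>x. LINT y|M2. (f x y)\<^sup>2)"
    by (rule integrable_fst[OF f2])
  show g2: "integrable M1 (\<lambda>x. (?g x)\<^sup>2)"
  proof (rule Bochner_Integration.integrable_bound[OF int])
    show "AE x in M1. norm ((?g x)\<^sup>2) \<le> norm (LINT y|M2. (f x y)\<^sup>2)"
      using le by eventually_elim simp
  qed measurable
  have "(LINT x|M1. (?g x)\<^sup>2) \<le> (LINT x|M1. LINT y|M2. (f x y)\<^sup>2)"
    by (rule integral_mono_AE[OF g2 int le])
  also have "\<dots> = expectation (\<lambda>p. (case_prod f p)\<^sup>2)"
    using integral_fst[OF f2] by (simp add: case_prod_beta')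
  finally have "(LINT x|M1. (?g x)\<^sup>2) \<le> expectation (\<lambda>p. (case_prod f p)\<^sup>2)" .
  then show "M1.variance ?g \<le> variance (case_prod f)"
    using M1.variance_eq[OF integrable_fst[OF f1] g2] variance_eq[OF f1 f2'] integral_fst[OF f1]
    by simp
qed

end

section \<open>The error averaged over training sets\<close>

lemma prob_space_sample_measure: "prob_space \<mu> \<Longrightarrow> prob_space (sample_measure \<mu> n)"
  unfolding sample_measure_def by (intro prob_space_PiM)

locale sampled_approximation =
  fixes \<mu> :: "'a measure" and n :: nat
    and F :: "'a \<Rightarrow> real" and Fs :: "'a \<Rightarrow> (nat \<Rightarrow> 'a) \<Rightarrow> real"
  assumes mu_prob: "prob_space \<mu>"
    and n_pos: "n \<ge> 1"
    and F_measurable [measurable]: "F \<in> borel_measurable \<mu>"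
    and F_square_integrable: "integrable \<mu> (\<lambda>y. (F y)\<^sup>2)"
    and Fs_measurable [measurable]:
      "(\<lambda>(y, S). Fs y S) \<in> borel_measurable (\<mu> \<Otimes>\<^sub>M sample_measure \<mu> n)"
    and Fs_square_integrable:
      "integrable (\<mu> \<Otimes>\<^sub>M sample_measure \<mu> n) (\<lambda>(y, S). (Fs y S)\<^sup>2)"
begin

sublocale pair_prob_space \<mu> "sample_measure \<mu> n"
proof -
  interpret M1: prob_space \<mu> by (rule mu_prob)
  interpret M2: prob_space "sample_measure \<mu> n" by (rule prob_space_sample_measure[OF mu_prob])
  show "pair_prob_space \<mu> (sample_measure \<mu> n)" ..
qed

definition error :: "'a \<Rightarrow> (nat \<Rightarrow> 'a) \<Rightarrow> real" where
  "error y S = \<bar>F y - Fs y S\<bar>"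

definition mean_error :: "'a \<Rightarrow> real" where
  "mean_error y = (LINT S|sample_measure \<mu> n. error y S)"

lemma integral_fst_coordinate:
  fixes G :: "'a \<Rightarrow> real"
  assumes "integrable \<mu> G"
  shows "integrable (\<mu> \<Otimes>\<^sub>M sample_measure \<mu> n) (\<lambda>p. G (fst p))"
    and "(LINT p|(\<mu> \<Otimes>\<^sub>M sample_measure \<mu> n). G (fst p)) = (LINT y|\<mu>. G y)"
proof -
  have fst: "distr (\<mu> \<Otimes>\<^sub>M sample_measure \<mu> n) \<mu> fst = \<mu>"
    by (rule M2.distr_pair_fst)
  show "integrable (\<mu> \<Otimes>\<^sub>M sample_measure \<mu> n) (\<lambda>p. G (fst p))"
    using assms by (intro integrable_distr[OF measurable_fst]) (simp add: fst)
  show "(LINT p|(\<mu> \<Otimes>\<^sub>M sample_measure \<mu> n). G (fst p)) = (LINT y|\<mu>. G y)"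
    using integral_distr[of fst "\<mu> \<Otimes>\<^sub>M sample_measure \<mu> n" \<mu> G] assms by (simp add: fst)
qed

lemma error_measurable [measurable]:
  "case_prod error \<in> borel_measurable (\<mu> \<Otimes>\<^sub>M sample_measure \<mu> n)"
  unfolding error_def by measurable

lemma mean_error_measurable [measurable]: "mean_error \<in> borel_measurable \<mu>"
  unfolding mean_error_def by measurable

lemma difference_square_integrable:
  "integrable (\<mu> \<Otimes>\<^sub>M sample_measure \<mu> n) (\<lambda>p. (F (fst p) - (case p of (y, S) \<Rightarrow> Fs y S))\<^sup>2)"
  using integral_fst_coordinate(1)[OF F_square_integrable] Fs_square_integrable
  by (intro square_integrable_diff) (auto simp: case_prod_beta')

lemma error_square_integrable:
  "integrable (\<mu> \<Otimes>\<^sub>M sample_measure \<mu> n) (\<lambda>(y, S). (error y S)\<^sup>2)"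
  using difference_square_integrable by (simp add: error_def case_prod_beta')

lemma error_integrable: "integrable (\<mu> \<Otimes>\<^sub>M sample_measure \<mu> n) (case_prod error)"
  by (rule square_integrable_imp_integrable[OF error_measurable])
     (use error_square_integrable in \<open>simp add: case_prod_beta'\<close>)

lemma mean_error_square_integrable: "integrable \<mu> (\<lambda>y. (mean_error y)\<^sup>2)"
  unfolding mean_error_def
  by (rule marginal_square_integrable[OF error_measurable error_square_integrable])

lemma generalization_error_eq: "generalization_error \<mu> n F Fs = (LINT y|\<mu>. mean_error y)"
  unfolding generalization_error_def mean_error_def error_def[symmetric]
  by (rule Fubini_integral[OF error_integrable])

text \<open>
  Neither the average over \<open>S\<close> nor the absolute value increases the variance on the product space,
  and there the variance of a difference is at most twice the sum of the variances.
\<close>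

lemma mean_error_variance_le:
  "M1.variance mean_error \<le> 2 * (map_variance \<mu> F + net_variance \<mu> n Fs)"
proof -
  let ?F = "\<lambda>p. F (fst p)" and ?G = "\<lambda>p. case p of (y, S) \<Rightarrow> Fs y S"
  have F2: "integrable (\<mu> \<Otimes>\<^sub>M sample_measure \<mu> n) (\<lambda>p. (?F p)\<^sup>2)"
    by (rule integral_fst_coordinate(1)[OF F_square_integrable])
  have G2: "integrable (\<mu> \<Otimes>\<^sub>M sample_measure \<mu> n) (\<lambda>p. (?G p)\<^sup>2)"
    using Fs_square_integrable by (simp add: case_prod_beta')
  have F1: "integrable \<mu> F"
    by (rule M1.square_integrable_imp_integrable[OF F_measurable F_square_integrable])
  have G1: "integrable (\<mu> \<Otimes>\<^sub>M sample_measure \<mu> n) (\<lambda>(y, S). Fs y S)"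
    by (rule square_integrable_imp_integrable[OF Fs_measurable G2])
  have "M1.variance mean_error \<le> variance (case_prod error)"
    unfolding mean_error_def
    by (rule marginal_variance_le[OF error_measurable error_square_integrable])
  also have "\<dots> = variance (\<lambda>p. \<bar>?F p - ?G p\<bar>)"
    by (simp add: error_def case_prod_beta')
  also have "\<dots> \<le> variance (\<lambda>p. ?F p - ?G p)"
    by (rule variance_abs_le[OF _ difference_square_integrable]) measurable
  also have "\<dots> \<le> 2 * (variance ?F + variance ?G)"
    by (rule variance_diff_le[OF _ _ F2 G2]) measurable
  also have "variance ?F = map_variance \<mu> F"
    using variance_eq[OF integral_fst_coordinate(1)[OF F1] F2]
      integral_fst_coordinate(2)[OF F1] integral_fst_coordinate(2)[OF F_square_integrable]
    by (simp add: map_variance_def)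
  also have "variance ?G = net_variance \<mu> n Fs"
    using variance_eq[OF G1 G2] integral_fst[OF G1] integral_fst[OF Fs_square_integrable]
    by (simp add: net_variance_def case_prod_beta')
  finally show ?thesis .
qed

lemma validation_error_eq:
  assumes "\<And>j. j \<in> {1..n} \<Longrightarrow> integrable (sample_measure \<mu> n) (error (z j \<omega>))"
  shows "validation_error \<mu> n F Fs z \<omega> = (\<Sum>j=1..n. mean_error (z j \<omega>)) / real n"
  unfolding validation_error_def mean_error_def error_def[symmetric]
  using assms by (subst Bochner_Integration.integral_sum) auto

text \<open>
  For almost every \<open>\<omega>\<close> the integral over training sets may be exchanged with the sum over validation
  points, so that the validation error is the sample mean of \<open>mean_error\<close>, to which the Monte Carlo
  estimate applies.
\<close>

lemma generalization_gap_le: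
  fixes P :: "'w measure" and z :: "nat \<Rightarrow> 'w \<Rightarrow> 'a"
  assumes P: "prob_space P"
    and indep: "prob_space.indep_vars P (\<lambda>_. \<mu>) z {1..n}"
    and law: "\<And>j. j \<in> {1..n} \<Longrightarrow> distr P \<mu> (z j) = \<mu>"
  shows "\<bar>generalization_error \<mu> n F Fs - training_error \<mu> n F Fs\<bar>
      \<le> validation_gap P \<mu> n F Fs z + sqrt (8 * (map_variance \<mu> F + net_variance \<mu> n Fs) / real n)"
proof -
  interpret V: prob_space P by (rule P)
  let ?G = "generalization_error \<mu> n F Fs" and ?T = "training_error \<mu> n F Fs"
  let ?V = "validation_error \<mu> n F Fs z"
  let ?A = "\<lambda>\<omega>. (\<Sum>j=1..n. mean_error (z j \<omega>)) / real n"
  have z[measurable]: "z j \<in> measurable P \<mu>" if "j \<in> {1..n}" for j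
    using indep that by (auto simp: V.indep_vars_def)
  have transfer: "integrable P (\<lambda>\<omega>. g (z j \<omega>)) \<and> (LINT \<omega>|P. g (z j \<omega>)) = (LINT y|\<mu>. g y)"
    if "j \<in> {1..n}" "integrable \<mu> g" for j and g :: "'a \<Rightarrow> real"
    using that integrable_distr[OF z, of j g] integral_distr[OF z, of j g] law[of j] by auto
  have mean_error: "integrable \<mu> mean_error"
    by (rule M1.square_integrable_imp_integrable[OF mean_error_measurable mean_error_square_integrable])
  have A: "integrable P ?A"
    using transfer[OF _ mean_error] by (intro integrable_divide Bochner_Integration.integrable_sum) auto
  have validation: "AE \<omega> in P. ?V \<omega> = ?A \<omega>"
  proof -
    have "AE \<omega> in P. \<forall>j\<in>{1..n}. integrable (sample_measure \<mu> n) (error (z j \<omega>))"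
    proof (subst AE_ball_countable, simp, rule ballI)
      fix j assume j: "j \<in> {1..n}"
      have "AE y in distr P \<mu> (z j). integrable (sample_measure \<mu> n) (error y)"
        unfolding law[OF j] by (rule AE_integrable_fst[OF error_integrable])
      then show "AE \<omega> in P. integrable (sample_measure \<mu> n) (error (z j \<omega>))"
        by (rule AE_distrD[OF z[OF j]])
    qed
    then show ?thesis
      by eventually_elim (rule validation_error_eq, blast)
  qed
  \<comment> \<open>\<open>?V\<close> can differ from \<open>?A\<close> where some \<open>error (z j \<omega>)\<close> is not integrable and its integral is
      \<open>0\<close> by convention; this is a null set.\<close>
  have gap: "validation_gap P \<mu> n F Fs z = (LINT \<omega>|P. \<bar>?T - ?A \<omega>\<bar>)"
    unfolding validation_gap_def
  proof (rule integral_cong_AE)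
    have [measurable]: "(\<lambda>(\<omega>, S). error (z j \<omega>) S) \<in> borel_measurable (P \<Otimes>\<^sub>M sample_measure \<mu> n)"
      if "j \<in> {1..n}" for j
      using z[OF that] by measurable
    have "?V \<in> borel_measurable P"
      unfolding validation_error_def error_def[symmetric] by measurable
    then show "(\<lambda>\<omega>. \<bar>?T - ?V \<omega>\<bar>) \<in> borel_measurable P"
      by measurable
    show "(\<lambda>\<omega>. \<bar>?T - ?A \<omega>\<bar>) \<in> borel_measurable P"
      using A by (intro borel_measurable_integrable) auto
    show "AE \<omega> in P. \<bar>?T - ?V \<omega>\<bar> = \<bar>?T - ?A \<omega>\<bar>"
      using validation by eventually_elim simp
  qed
  have "\<bar>?G - ?T\<bar> = (LINT \<omega>|P. \<bar>?G - ?T\<bar>)"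
    by (simp add: V.prob_space)
  also have "\<dots> \<le> (LINT \<omega>|P. \<bar>?T - ?A \<omega>\<bar> + \<bar>?G - ?A \<omega>\<bar>)"
    using A by (intro integral_mono) auto
  also have "\<dots> = validation_gap P \<mu> n F Fs z + (LINT \<omega>|P. \<bar>?G - ?A \<omega>\<bar>)"
    using A by (simp add: gap)
  also have "(LINT \<omega>|P. \<bar>?G - ?A \<omega>\<bar>) \<le> sqrt (M1.variance mean_error / real n)"
  proof -
    have "(LINT \<omega>|P. \<bar>?G - (\<Sum>j\<in>{1..n}. mean_error (z j \<omega>)) / real (card {1..n})\<bar>)
        \<le> sqrt (M1.variance mean_error / real (card {1..n}))"
    proof (rule V.sample_mean_deviation_le)
      show "V.indep_vars (\<lambda>_. borel) (\<lambda>j \<omega>. mean_error (z j \<omega>)) {1..n}"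
        by (rule V.indep_vars_compose2[OF indep]) measurable
      show "integrable P (\<lambda>\<omega>. (mean_error (z j \<omega>))\<^sup>2)" if "j \<in> {1..n}" for j
        using transfer[OF that mean_error_square_integrable] by blast
      show mean: "(LINT \<omega>|P. mean_error (z j \<omega>)) = ?G" if "j \<in> {1..n}" for j
        using transfer[OF that mean_error] by (simp add: generalization_error_eq)
      show "V.variance (\<lambda>\<omega>. mean_error (z j \<omega>)) = M1.variance mean_error" if "j \<in> {1..n}" for j
        using transfer[OF that, of "\<lambda>y. (mean_error y - ?G)\<^sup>2"] mean[OF that]
          M1.square_integrable_shift[OF mean_error_measurable mean_error_square_integrable]
        by (simp add: generalization_error_eq)
    qed (use n_pos in auto)
    then show ?thesis by simp
  qed
  also have "\<dots> \<le> sqrt (8 * (map_variance \<mu> F + net_variance \<mu> n Fs) / real n)"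
  proof -
    \<comment> \<open>Passing from the factor \<open>2\<close> to \<open>8\<close> uses that the sum of the variances, being a bound for a
        variance, is nonnegative.\<close>
    have "M1.variance mean_error \<le> 8 * (map_variance \<mu> F + net_variance \<mu> n Fs)"
      using mean_error_variance_le M1.variance_positive[of mean_error] by linarith
    then show ?thesis
      by (intro real_sqrt_le_mono divide_right_mono) auto
  qed
  finally show ?thesis by simp
qed

end

section \<open>Splitting the multilevel error\<close>

lemma level_map_telescope: "(\<Sum>l\<le>L. level_map obs \<Delta> l y) = obs (\<Delta> L) y"
  by (induction L) auto

text \<open>
  The inner integral of the multilevel error is compared with the sum of the level integrals only for
  almost every family of training sets, namely when every level error is integrable in \<open>y\<close>. The
  component projections preserve measure, which transfers null sets and integrals from a single
  sample space to the product.
\<close>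

lemma ml_generalization_error_le:
  fixes \<mu> :: "'a measure"
  assumes level: "\<And>l. l \<le> L \<Longrightarrow> sampled_approximation \<mu> (N l) (F l) (Fs l)"
    and decomposition: "\<And>y. G y = (\<Sum>l\<le>L. F l y)"
  shows "ml_generalization_error \<mu> L N G Fs \<le> (\<Sum>l\<le>L. generalization_error \<mu> (N l) (F l) (Fs l))"
proof -
  have mu: "prob_space \<mu>"
    using level[of 0] by (simp add: sampled_approximation_def)
  let ?M = "\<lambda>l. sample_measure \<mu> (N l)" and ?P = "ml_sample_measure \<mu> L N"
  let ?e = "\<lambda>l S. LINT y|\<mu>. \<bar>F l y - Fs l y S\<bar>"
  have comp: "distr ?P (?M l) (\<lambda>Sbar. Sbar l) = ?M l" if "l \<le> L" for l
    unfolding ml_sample_measure_def using that prob_space_sample_measure[OF mu]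
    by (intro distr_PiM_component) auto
  have proj[measurable]: "(\<lambda>Sbar. Sbar l) \<in> measurable ?P (?M l)" if "l \<le> L" for l
    unfolding ml_sample_measure_def using that by (intro measurable_component_singleton) auto
  have e: "integrable (?M l) (?e l)" and
    slice: "AE S in ?M l. integrable \<mu> (\<lambda>y. \<bar>F l y - Fs l y S\<bar>)" if "l \<le> L" for l
  proof -
    interpret sampled_approximation \<mu> "N l" "F l" "Fs l"
      by (rule level[OF that])
    show "integrable (?M l) (?e l)" "AE S in ?M l. integrable \<mu> (\<lambda>y. \<bar>F l y - Fs l y S\<bar>)"
      using integrable_snd[OF error_integrable] AE_integrable_snd[OF error_integrable]
      by (simp_all add: error_def)
  qed
  have e': "integrable ?P (\<lambda>Sbar. ?e l (Sbar l))"
    "(LINT Sbar|?P. ?e l (Sbar l)) = generalization_error \<mu> (N l) (F l) (Fs l)" if "l \<le> L" for l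
    using integrable_distr[OF proj[OF that], of "?e l"] integral_distr[OF proj[OF that], of "?e l"]
      e[OF that] comp[OF that] unfolding generalization_error_def by auto
  have pointwise: "\<bar>G y - ml_net L Fs y Sbar\<bar> \<le> (\<Sum>l\<le>L. \<bar>F l y - Fs l y (Sbar l)\<bar>)" for y Sbar
  proof -
    have "ml_net L Fs y Sbar = (\<Sum>l\<le>L. Fs l y (Sbar l))"
      by (simp add: ml_net_def atMost_atLeast0 sum.atLeast_Suc_atMost)
    then have "G y - ml_net L Fs y Sbar = (\<Sum>l\<le>L. F l y - Fs l y (Sbar l))"
      by (simp add: decomposition sum_subtractf)
    then show ?thesis
      by (simp add: sum_abs)
  qed
  have "AE Sbar in ?P. \<forall>l\<in>{..L}. integrable \<mu> (\<lambda>y. \<bar>F l y - Fs l y (Sbar l)\<bar>)"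
  proof (subst AE_ball_countable, simp, rule ballI)
    fix l assume "l \<in> {..L}"
    then have l: "l \<le> L" by simp
    have "AE S in distr ?P (?M l) (\<lambda>Sbar. Sbar l). integrable \<mu> (\<lambda>y. \<bar>F l y - Fs l y S\<bar>)"
      unfolding comp[OF l] by (rule slice[OF l])
    then show "AE Sbar in ?P. integrable \<mu> (\<lambda>y. \<bar>F l y - Fs l y (Sbar l)\<bar>)"
      by (rule AE_distrD[OF proj[OF l]])
  qed
  then have inner: "AE Sbar in ?P. (LINT y|\<mu>. \<bar>G y - ml_net L Fs y Sbar\<bar>) \<le> (\<Sum>l\<le>L. ?e l (Sbar l))"
  proof eventually_elim
    case (elim Sbar)
    then have "(LINT y|\<mu>. \<bar>G y - ml_net L Fs y Sbar\<bar>)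
        \<le> (LINT y|\<mu>. (\<Sum>l\<le>L. \<bar>F l y - Fs l y (Sbar l)\<bar>))"
      using pointwise by (intro integral_mono') (auto intro!: sum_nonneg)
    also have "\<dots> = (\<Sum>l\<le>L. ?e l (Sbar l))"
      using elim by (intro Bochner_Integration.integral_sum) auto
    finally show ?case .
  qed
  have "ml_generalization_error \<mu> L N G Fs \<le> (LINT Sbar|?P. (\<Sum>l\<le>L. ?e l (Sbar l)))"
    unfolding ml_generalization_error_def using inner e'
    by (intro integral_mono_AE') (auto intro!: sum_nonneg)
  also have "\<dots> = (\<Sum>l\<le>L. generalization_error \<mu> (N l) (F l) (Fs l))"
    using e' by (subst Bochner_Integration.integral_sum) auto
  finally show ?thesis .
qed

section \<open>The multilevel estimates\<close>

theorem lemma3p3: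
  fixes \<mu> :: "(real ^ 'd) measure"
    and P :: "'w measure"
    and L :: nat
    and N :: "nat \<Rightarrow> nat"
    and \<Delta> :: "nat \<Rightarrow> real"
    and obs :: "real \<Rightarrow> real ^ 'd \<Rightarrow> real"
    and dims :: "nat \<Rightarrow> nat list"
    and \<Theta> :: "nat \<Rightarrow> weight_tuple set"
    and p lam :: "nat \<Rightarrow> real"
    and R :: "nat \<Rightarrow> weight_tuple \<Rightarrow> real"
    and opt :: "nat \<Rightarrow> ((real ^ 'd) \<times> real) list \<Rightarrow> (weight_tuple \<Rightarrow> real) \<Rightarrow> weight_tuple"
    and z :: "nat \<Rightarrow> nat \<Rightarrow> 'w \<Rightarrow> real ^ 'd"
    and F :: "nat \<Rightarrow> real ^ 'd \<Rightarrow> real"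
    and Fs :: "nat \<Rightarrow> real ^ 'd \<Rightarrow> (nat \<Rightarrow> real ^ 'd) \<Rightarrow> real"
  assumes mu_prob: "prob_space \<mu>"
    and mu_cube: "sets \<mu> = sets (restrict_space borel (cbox 0 1))"
    and L_pos: "L \<ge> 1"
    and N_pos: "\<And>l. l \<le> L \<Longrightarrow> N l \<ge> 1"
    and resolutions_decr: "\<And>l. l < L \<Longrightarrow> \<Delta> l > \<Delta> (Suc l)"
    and resolutions_pos: "\<Delta> L > 0"
    and F_def: "\<And>l. l \<le> L \<Longrightarrow> F l = level_map obs \<Delta> l"
    and archs: "\<And>l. l \<le> L \<Longrightarrow> architecture CARD('d) (dims l)"
    and Theta_weights: "\<And>l. l \<le> L \<Longrightarrow> \<Theta> l \<subseteq> weights (dims l)"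
    and p_ge_1: "\<And>l. l \<le> L \<Longrightarrow> p l \<ge> 1"
    and lam_nonneg: "\<And>l. l \<le> L \<Longrightarrow> lam l \<ge> 0"
    and training_Theta: "\<And>l S. l \<le> L \<Longrightarrow> S \<in> space (sample_measure \<mu> (N l)) \<Longrightarrow>
           trained_weights (opt l) (p l) (lam l) (R l) (N l) (F l) S \<in> \<Theta> l"
    and Fs_def: "\<And>l. l \<le> L \<Longrightarrow> Fs l = trained_net (opt l) (p l) (lam l) (R l) (N l) (F l)"
    and F_measurable: "\<And>l. l \<le> L \<Longrightarrow> F l \<in> borel_measurable \<mu>"
    and F_sq_integrable: "\<And>l. l \<le> L \<Longrightarrow> integrable \<mu> (\<lambda>y. (F l y)\<^sup>2)"
    and Fs_measurable: "\<And>l. l \<le> L \<Longrightarrow>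
           (\<lambda>(y, S). Fs l y S) \<in> borel_measurable (\<mu> \<Otimes>\<^sub>M sample_measure \<mu> (N l))"
    and Fs_sq_integrable: "\<And>l. l \<le> L \<Longrightarrow>
           integrable (\<mu> \<Otimes>\<^sub>M sample_measure \<mu> (N l)) (\<lambda>(y, S). (Fs l y S)\<^sup>2)"
    and P_prob: "prob_space P"
    and P_complete: "complete_measure P"
    and z_indep: "\<And>l. l \<le> L \<Longrightarrow> prob_space.indep_vars P (\<lambda>_. \<mu>) (z l) {1..N l}"
    and z_law: "\<And>l j. l \<le> L \<Longrightarrow> j \<in> {1..N l} \<Longrightarrow> distr P \<mu> (z l j) = \<mu>"
  shows "ml_generalization_error \<mu> L N (obs (\<Delta> L)) Fs
           \<le> generalization_error \<mu> (N 0) (F 0) (Fs 0)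
             + (\<Sum>l=1..L. generalization_error \<mu> (N l) (F l) (Fs l))
       \<and> \<bar>generalization_error \<mu> (N 0) (F 0) (Fs 0) - training_error \<mu> (N 0) (F 0) (Fs 0)\<bar>
           \<le> validation_gap P \<mu> (N 0) (F 0) (Fs 0) (z 0)
             + sqrt (8 * (map_variance \<mu> (F 0) + net_variance \<mu> (N 0) (Fs 0)) / real (N 0))
       \<and> (\<forall>l\<in>{1..L}. \<bar>generalization_error \<mu> (N l) (F l) (Fs l) - training_error \<mu> (N l) (F l) (Fs l)\<bar>
           \<le> validation_gap P \<mu> (N l) (F l) (Fs l) (z l)
             + sqrt (8 * (map_variance \<mu> (F l) + net_variance \<mu> (N l) (Fs l)) / real (N l)))"
proof -
  have level: "sampled_approximation \<mu> (N l) (F l) (Fs l)" if "l \<le> L" for l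
    by (intro sampled_approximation.intro mu_prob N_pos F_measurable F_sq_integrable
        Fs_measurable Fs_sq_integrable that)
  have gap: "\<bar>generalization_error \<mu> (N l) (F l) (Fs l) - training_error \<mu> (N l) (F l) (Fs l)\<bar>
      \<le> validation_gap P \<mu> (N l) (F l) (Fs l) (z l)
        + sqrt (8 * (map_variance \<mu> (F l) + net_variance \<mu> (N l) (Fs l)) / real (N l))"
    if "l \<le> L" for l
    using z_law[OF that]
    by (rule sampled_approximation.generalization_gap_le[OF level[OF that] P_prob z_indep[OF that]])
  have "obs (\<Delta> L) y = (\<Sum>l\<le>L. F l y)" for y
    by (simp add: F_def level_map_telescope)
  then have "ml_generalization_error \<mu> L N (obs (\<Delta> L)) Fs
      \<le> (\<Sum>l\<le>L. generalization_error \<mu> (N l) (F l) (Fs l))"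
    using level by (intro ml_generalization_error_le)
  then have "ml_generalization_error \<mu> L N (obs (\<Delta> L)) Fs
      \<le> generalization_error \<mu> (N 0) (F 0) (Fs 0)
        + (\<Sum>l=1..L. generalization_error \<mu> (N l) (F l) (Fs l))"
    by (simp add: atMost_atLeast0 sum.atLeast_Suc_atMost)
  with gap show ?thesis
    by simp
qed

end
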